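(* Let $f=h\overline{g}$ be a non-vanishing, sense-preserving and locally univalent log-harmonic mapping in the unit disk $\mathbb{D}$ with dilatation $\omega=\dfrac{g'h}{h'g}$. Then either $\|P_f\|=\|P_{hg}\|=\infty$, or both $\|P_f\|$ and $\|P_{hg}\|$ are finite. If $\|P_f\|$ is finite, then $$\bigl|\,\|P_f\|-\|P_{hg}\|\,\bigr|\le 1,$$ and the constant $1$ is sharp (it cannot be replaced by any smaller constant valid for all such $f$).
   Context: $\mathbb{D}=\{z\in\mathbb{C}:|z|<1\}$. A non-vanishing log-harmonic mapping in $\mathbb{D}$ is a function $f=h\overline{g}$ with $h,g$ non-vanishing analytic functions in $\mathbb{D}$, solving $\overline{f_{\bar z}}/\overline{f}=\omega\, f_z/f$ for some analytic $\omega:\mathbb{D}\to\mathbb{D}$ (the second complex dilatation). It is sense-preserving and locally univalent when its Jacobian $J_f=|f_z|^2-|f_{\bar z}|^2=|h'g|^2(1-|\omega|^2)$ is positive in $\mathbb{D}$; then $h'g\ne 0$ in $\mathbb{D}$ and $\omega=g'h/(h'g)$. Pre-Schwarzian derivative of such an $f$: $P_f=\dfrac{\partial}{\partial z}\log J_f=\dfrac{h''}{h'}+\dfrac{g'}{g}-\dfrac{\overline{\omega}\,\omega'}{1-|\omega|^2}$. For a locally univalent analytic function $F$ in $\mathbb{D}$: $P_F=F''/F'$. In both cases the pre-Schwarzian norm is $\|P_F\|=\sup_{z\in\mathbb{D}}(1-|z|^2)|P_F(z)|\in[0,\infty]$. The function $hg$ is analytic and locally univalent in $\mathbb{D}$,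 since $(hg)'=h'g(1+\omega)$. *)

theory Defs
  imports "HOL-Complex_Analysis.Complex_Analysis"
begin

abbreviation unit_disk :: "complex set" where
  "unit_disk \<equiv> ball 0 1"

text \<open>The Wirtinger operators \<open>\<partial>/\<partial>z = (\<partial>/\<partial>x - \<i> \<partial>/\<partial>y)/2\<close> and
  \<open>\<partial>/\<partial>\<bar>z = (\<partial>/\<partial>x + \<i> \<partial>/\<partial>y)/2\<close>, where the real partial derivatives are the values of
  the real Frechet derivative in the directions \<open>1\<close> and \<open>\<i>\<close>.  They are only meaningful
  at points of real differentiability.\<close>

definition wirtinger_z :: "(complex \<Rightarrow> complex) \<Rightarrow> complex \<Rightarrow> complex" where
  "wirtinger_z F z =
     (frechet_derivative F (at z) 1 - \<i> * frechet_derivative F (at z) \<i>) / 2"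

definition wirtinger_zbar :: "(complex \<Rightarrow> complex) \<Rightarrow> complex \<Rightarrow> complex" where
  "wirtinger_zbar F z =
     (frechet_derivative F (at z) 1 + \<i> * frechet_derivative F (at z) \<i>) / 2"

definition jacobian :: "(complex \<Rightarrow> complex) \<Rightarrow> complex \<Rightarrow> real" where
  "jacobian f z = (cmod (wirtinger_z f z))\<^sup>2 - (cmod (wirtinger_zbar f z))\<^sup>2"

definition nonvanishing_log_harmonic ::
    "(complex \<Rightarrow> complex) \<Rightarrow> (complex \<Rightarrow> complex) \<Rightarrow> (complex \<Rightarrow> complex) \<Rightarrow>
     (complex \<Rightarrow> complex) \<Rightarrow> bool" where
  "nonvanishing_log_harmonic f h g \<omega> \<longleftrightarrow>
     h holomorphic_on unit_disk \<and> g holomorphic_on unit_disk \<and>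
     (\<forall>z\<in>unit_disk. h z \<noteq> 0 \<and> g z \<noteq> 0) \<and>
     (\<forall>z\<in>unit_disk. f z = h z * cnj (g z)) \<and>
     \<omega> holomorphic_on unit_disk \<and> \<omega> ` unit_disk \<subseteq> unit_disk \<and>
     (\<forall>z\<in>unit_disk. cnj (wirtinger_zbar f z) / cnj (f z) = \<omega> z * (wirtinger_z f z / f z))"

text \<open>Positivity of the Jacobian is taken as the definition of being sense-preserving and
  locally univalent; for log-harmonic mappings the two agree by Lewy's theorem.\<close>

definition sense_preserving_locally_univalent :: "(complex \<Rightarrow> complex) \<Rightarrow> bool" where
  "sense_preserving_locally_univalent f \<longleftrightarrow> (\<forall>z\<in>unit_disk. jacobian f z > 0)"

definition pre_schwarzian :: "(complex \<Rightarrow> complex) \<Rightarrow> complex \<Rightarrow> complex" where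
  "pre_schwarzian f = wirtinger_z (\<lambda>z. complex_of_real (ln (jacobian f z)))"

definition analytic_pre_schwarzian :: "(complex \<Rightarrow> complex) \<Rightarrow> complex \<Rightarrow> complex" where
  "analytic_pre_schwarzian F z = deriv (deriv F) z / deriv F z"

text \<open>The weighted supremum norm of a pre-Schwarzian derivative \<open>P\<close>, with values in
  \<open>[0, \<infinity>]\<close>.\<close>

definition pre_schwarzian_norm :: "(complex \<Rightarrow> complex) \<Rightarrow> ereal" where
  "pre_schwarzian_norm P = (SUP z\<in>unit_disk. ereal ((1 - (cmod z)\<^sup>2) * cmod (P z)))"


text \<open>Agreement with the explicit expressions in terms of \<open>h\<close>, \<open>g\<close> and \<open>\<omega>\<close>.\<close>

lemma wirtinger_eqI:
  assumes "(F has_derivative (\<lambda>w. a * w + b * cnj w)) (at z)"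
  shows "wirtinger_z F z = a" "wirtinger_zbar F z = b"
proof -
  have "frechet_derivative F (at z) = (\<lambda>w. a * w + b * cnj w)"
    using frechet_derivative_at[OF assms] by simp
  then show "wirtinger_z F z = a" "wirtinger_zbar F z = b"
    by (simp_all add: wirtinger_z_def wirtinger_zbar_def algebra_simps)
qed

lemma log_harmonic_wirtinger:
  assumes "nonvanishing_log_harmonic f h g \<omega>" "z \<in> unit_disk"
  shows "wirtinger_z f z = deriv h z * cnj (g z)"
    and "wirtinger_zbar f z = h z * cnj (deriv g z)"
proof -
  have hol: "h holomorphic_on unit_disk" "g holomorphic_on unit_disk"
    and eq: "\<And>w. w \<in> unit_disk \<Longrightarrow> f w = h w * cnj (g w)"
    using assms(1) by (auto simp: nonvanishing_log_harmonic_def)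
  have dh: "(h has_derivative (*) (deriv h z)) (at z)"
    and dg: "(g has_derivative (*) (deriv g z)) (at z)"
    using hol[THEN holomorphic_derivI, OF open_ball assms(2)]
    by (auto simp: has_field_derivative_def)
  have "((\<lambda>w. h w * cnj (g w)) has_derivative
          (\<lambda>w. (deriv h z * cnj (g z)) * w + (h z * cnj (deriv g z)) * cnj w)) (at z)"
    by (rule derivative_eq_intros bounded_linear.has_derivative[OF bounded_linear_cnj] dh dg
        | simp add: algebra_simps)+
  then have "(f has_derivative
          (\<lambda>w. (deriv h z * cnj (g z)) * w + (h z * cnj (deriv g z)) * cnj w)) (at z)"
    by (rule has_derivative_transform_within_open[OF _ open_ball assms(2)]) (simp add: eq)
  then show "wirtinger_z f z = deriv h z * cnj (g z)"
    "wirtinger_zbar f z = h z * cnj (deriv g z)"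
    by (auto dest: wirtinger_eqI)
qed

lemma log_harmonic_jacobian:
  assumes "nonvanishing_log_harmonic f h g \<omega>" "z \<in> unit_disk"
  shows "jacobian f z = (cmod (deriv h z * g z))\<^sup>2 * (1 - (cmod (\<omega> z))\<^sup>2)"
    and "deriv g z * h z = \<omega> z * (deriv h z * g z)"
proof -
  have nz: "h z \<noteq> 0" "g z \<noteq> 0" "f z = h z * cnj (g z)"
    and pde: "cnj (wirtinger_zbar f z) / cnj (f z) = \<omega> z * (wirtinger_z f z / f z)"
    using assms by (auto simp: nonvanishing_log_harmonic_def)
  have "deriv g z / g z = \<omega> z * (deriv h z / h z)"
    using pde nz log_harmonic_wirtinger[OF assms] by simp
  then show *: "deriv g z * h z = \<omega> z * (deriv h z * g z)"
    using nz by (simp add: field_simps)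
  have "cmod (h z * cnj (deriv g z)) = cmod (deriv g z * h z)"
    by (simp add: norm_mult)
  then show "jacobian f z = (cmod (deriv h z * g z))\<^sup>2 * (1 - (cmod (\<omega> z))\<^sup>2)"
    unfolding jacobian_def log_harmonic_wirtinger[OF assms] *
    by (simp add: norm_mult power_mult_distrib algebra_simps)
qed

lemma log_harmonic_dilatation:
  assumes "nonvanishing_log_harmonic f h g \<omega>" "sense_preserving_locally_univalent f"
    and "z \<in> unit_disk"
  shows "deriv h z * g z \<noteq> 0" and "\<omega> z = deriv g z * h z / (deriv h z * g z)"
proof -
  have "jacobian f z > 0"
    using assms by (auto simp: sense_preserving_locally_univalent_def)
  then show *: "deriv h z * g z \<noteq> 0"
    unfolding log_harmonic_jacobian(1)[OF assms(1,3)] by auto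
  then show "\<omega> z = deriv g z * h z / (deriv h z * g z)"
    using log_harmonic_jacobian(2)[OF assms(1,3)] by (simp add: field_simps)
qed

lemma has_derivative_ln_cmod2:
  assumes "(k has_field_derivative k') (at z)" "k z \<noteq> 0"
  shows "((\<lambda>w. complex_of_real (ln ((cmod (k w))\<^sup>2))) has_derivative
          (\<lambda>w. (k' / k z) * w + cnj (k' / k z) * cnj w)) (at z)"
proof -
  have dk: "(k has_derivative (*) k') (at z)"
    using assms(1) by (simp add: has_field_derivative_def)
  have "((\<lambda>w. (k w) \<bullet> (k w)) has_derivative (\<lambda>w. k z \<bullet> (k' * w) + (k' * w) \<bullet> k z)) (at z)"
    by (rule has_derivative_inner[OF dk dk])
  then have "((\<lambda>w. ln ((k w) \<bullet> (k w))) has_derivative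
      (\<lambda>w. (k z \<bullet> (k' * w) + (k' * w) \<bullet> k z) * inverse (k z \<bullet> k z))) (at z)"
    by (rule has_derivative_ln[rotated]) (use assms(2) in simp)
  then have "((\<lambda>w. complex_of_real (ln ((k w) \<bullet> (k w)))) has_derivative
      (\<lambda>w. of_real ((k z \<bullet> (k' * w) + (k' * w) \<bullet> k z) * inverse (k z \<bullet> k z)))) (at z)"
    by (rule has_derivative_of_real)
  moreover have "complex_of_real ((k z \<bullet> (k' * w) + (k' * w) \<bullet> k z) * inverse (k z \<bullet> k z))
      = (k' / k z) * w + cnj (k' / k z) * cnj w" for w
  proof -
    have "complex_of_real (k z \<bullet> k z) = k z * cnj (k z)"
      by (metis complex_norm_square dot_square_norm)
    moreover have "complex_of_real (k z \<bullet> (k' * w) + (k' * w) \<bullet> k z)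
        = k' * w * cnj (k z) + cnj (k' * w) * k z"
      by (simp add: complex_eq_iff inner_complex_def algebra_simps)
    ultimately show ?thesis
      using assms(2) by (simp add: field_simps)
  qed
  ultimately show ?thesis
    by (simp add: power2_norm_eq_inner)
qed

lemma has_derivative_ln_one_minus_cmod2:
  assumes "(k has_field_derivative k') (at z)" "cmod (k z) < 1"
  shows "((\<lambda>w. complex_of_real (ln (1 - (cmod (k w))\<^sup>2))) has_derivative
          (\<lambda>w. (- (cnj (k z) * k' / (1 - (cmod (k z))\<^sup>2))) * w
             + cnj (- (cnj (k z) * k' / (1 - (cmod (k z))\<^sup>2))) * cnj w)) (at z)"
proof -
  have lt: "k z \<bullet> k z < 1"
    using assms(2) by (simp add: dot_square_norm power_less_one_iff)
  have dk: "(k has_derivative (*) k') (at z)"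
    using assms(1) by (simp add: has_field_derivative_def)
  have "((\<lambda>w. (k w) \<bullet> (k w)) has_derivative (\<lambda>w. k z \<bullet> (k' * w) + (k' * w) \<bullet> k z)) (at z)"
    by (rule has_derivative_inner[OF dk dk])
  then have "((\<lambda>w. 1 - (k w) \<bullet> (k w)) has_derivative
      (\<lambda>w. 0 - (k z \<bullet> (k' * w) + (k' * w) \<bullet> k z))) (at z)"
    by (rule has_derivative_diff[OF has_derivative_const])
  then have "((\<lambda>w. ln (1 - (k w) \<bullet> (k w))) has_derivative
      (\<lambda>w. (0 - (k z \<bullet> (k' * w) + (k' * w) \<bullet> k z)) * inverse (1 - k z \<bullet> k z))) (at z)"
    by (rule has_derivative_ln[rotated]) (use lt in simp)
  then have "((\<lambda>w. complex_of_real (ln (1 - (k w) \<bullet> (k w)))) has_derivative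
      (\<lambda>w. of_real ((0 - (k z \<bullet> (k' * w) + (k' * w) \<bullet> k z)) * inverse (1 - k z \<bullet> k z)))) (at z)"
    by (rule has_derivative_of_real)
  moreover have "complex_of_real ((0 - (k z \<bullet> (k' * w) + (k' * w) \<bullet> k z)) * inverse (1 - k z \<bullet> k z))
      = (- (cnj (k z) * k' / (1 - (k z \<bullet> k z)))) * w
             + cnj (- (cnj (k z) * k' / (1 - (k z \<bullet> k z)))) * cnj w" for w
  proof -
    have "complex_of_real (0 - (k z \<bullet> (k' * w) + (k' * w) \<bullet> k z))
        = - (cnj (k z) * k' * w) - k z * cnj k' * cnj w"
      by (simp add: complex_eq_iff inner_complex_def algebra_simps)
    moreover have "complex_of_real (1 - k z \<bullet> k z) \<noteq> 0"
      using lt by (metis diff_gt_0_iff_gt less_irrefl of_real_eq_0_iff)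
    ultimately show ?thesis
      by (simp only: of_real_mult of_real_inverse complex_cnj_minus complex_cnj_divide
          complex_cnj_mult complex_cnj_cnj complex_cnj_complex_of_real)
        (simp add: divide_inverse algebra_simps)
  qed
  ultimately show ?thesis
    by (simp add: power2_norm_eq_inner)
qed

lemma pre_schwarzian_formula:
  assumes "nonvanishing_log_harmonic f h g \<omega>" "sense_preserving_locally_univalent f"
    and z: "z \<in> unit_disk"
  shows "pre_schwarzian f z = deriv (deriv h) z / deriv h z + deriv g z / g z
           - cnj (\<omega> z) * deriv \<omega> z / (1 - (cmod (\<omega> z))\<^sup>2)"
proof -
  have hol: "h holomorphic_on unit_disk" "g holomorphic_on unit_disk" "\<omega> holomorphic_on unit_disk"
    and sub: "\<omega> ` unit_disk \<subseteq> unit_disk"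
    using assms(1) by (simp_all add: nonvanishing_log_harmonic_def)
  have w1: "cmod (\<omega> w) < 1" if "w \<in> unit_disk" for w
    using image_subset_iff[THEN iffD1, OF sub] that by simp
  have hol': "deriv h holomorphic_on unit_disk"
    using hol(1) by (simp add: holomorphic_deriv)
  let ?k = "\<lambda>w. deriv h w * g w"
  let ?k' = "deriv (deriv h) z * g z + deriv g z * deriv h z"
  have nz: "\<And>w. w \<in> unit_disk \<Longrightarrow> ?k w \<noteq> 0"
    using log_harmonic_dilatation[OF assms(1,2)] by blast
  have dk: "(?k has_field_derivative ?k') (at z)"
    by (rule DERIV_mult holomorphic_derivI[OF hol' open_ball z] holomorphic_derivI[OF hol(2) open_ball z])+
  note d\<omega> = holomorphic_derivI[OF hol(3) open_ball z]
  have "((\<lambda>w. complex_of_real (ln ((cmod (?k w))\<^sup>2)) + complex_of_real (ln (1 - (cmod (\<omega> w))\<^sup>2)))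
      has_derivative (\<lambda>w. (?k' / ?k z - cnj (\<omega> z) * deriv \<omega> z / (1 - (cmod (\<omega> z))\<^sup>2)) * w +
        cnj (?k' / ?k z - cnj (\<omega> z) * deriv \<omega> z / (1 - (cmod (\<omega> z))\<^sup>2)) * cnj w)) (at z)"
    by (rule has_derivative_eq_rhs[OF has_derivative_add[OF
          has_derivative_ln_cmod2[OF dk nz[OF z]]
          has_derivative_ln_one_minus_cmod2[OF d\<omega> w1[OF z]]]])
      (simp only: complex_cnj_diff complex_cnj_minus diff_conv_add_uminus complex_cnj_add, simp only: algebra_simps)
  then have "((\<lambda>w. complex_of_real (ln (jacobian f w)))
      has_derivative (\<lambda>w. (?k' / ?k z - cnj (\<omega> z) * deriv \<omega> z / (1 - (cmod (\<omega> z))\<^sup>2)) * w +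
        cnj (?k' / ?k z - cnj (\<omega> z) * deriv \<omega> z / (1 - (cmod (\<omega> z))\<^sup>2)) * cnj w)) (at z)"
  proof (rule has_derivative_transform_within_open[OF _ open_ball z])
    fix w :: complex assume w: "w \<in> unit_disk"
    have "(cmod (?k w))\<^sup>2 > 0" "1 - (cmod (\<omega> w))\<^sup>2 > 0"
      using nz[OF w] w1[OF w] by (auto simp: power_less_one_iff)
    then show "complex_of_real (ln ((cmod (?k w))\<^sup>2)) + complex_of_real (ln (1 - (cmod (\<omega> w))\<^sup>2))
        = complex_of_real (ln (jacobian f w))"
      unfolding log_harmonic_jacobian(1)[OF assms(1) w]
      by (simp only: ln_mult_pos of_real_add)
  qed
  then have "pre_schwarzian f z = ?k' / ?k z - cnj (\<omega> z) * deriv \<omega> z / (1 - (cmod (\<omega> z))\<^sup>2)"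
    unfolding pre_schwarzian_def by (rule wirtinger_eqI)
  moreover have "?k' / ?k z = deriv (deriv h) z / deriv h z + deriv g z / g z"
    using nz[OF z] by (simp add: field_simps)
  ultimately show ?thesis by simp
qed

end

theory Submission imports Defs begin

text \<open>
  Write \<open>F = hg\<close>.  Since \<open>F' = h' g (1 + \<omega>)\<close>, taking logarithmic derivatives and comparing
  with the explicit expression for \<open>P\<^sub>f\<close> gives
  \[ P_f - P_F = - \frac{1 + \overline{\omega}}{1 + \omega} \cdot \frac{\omega'}{1 - |\omega|^2}. \]
  The first factor is unimodular, so \<open>|P\<^sub>f - P\<^sub>F|\<close> is exactly the hyperbolic derivative
  \<open>|\<omega>'| / (1 - |\<omega>|\<^sup>2)\<close> of the self-map \<open>\<omega>\<close> of the disk, and the Schwarz-Pick inequality bounds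
  it by \<open>1 / (1 - |z|\<^sup>2)\<close>.  The weighted functions whose suprema are the two norms thus differ
  pointwise by at most 1, and hence so do the suprema, in \<open>[0, \<infinity>]\<close>.

  For sharpness, the triangle inequality loses nothing when \<open>P\<^sub>F = 0\<close>, and Schwarz-Pick is an
  equality when \<open>\<omega>\<close> is an automorphism of the disk.  Both are achieved at once by \<open>F z = 1 + z\<close>
  and \<open>\<omega> z = z\<close>: then \<open>h'/h = F' / (F (1 + \<omega>)) = (1 + z)\<^sup>-\<^sup>2\<close>, so that
  \<open>log h\<close> may be taken to be \<open>- 1 / (1 + z)\<close>, and \<open>g = F / h\<close>.  Here the norms are exactly 1 and 0.
\<close>

section \<open>The Schwarz-Pick inequality\<close>

lemma Moebius_function_has_field_derivative:
  assumes "1 - cnj w * z \<noteq> 0"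
  shows "(Moebius_function 0 w has_field_derivative
           of_real (1 - (cmod w)\<^sup>2) / (1 - cnj w * z)\<^sup>2) (at z)"
proof -
  have "complex_of_real (1 - (cmod w)\<^sup>2) = 1 - w * cnj w"
    by (simp add: complex_norm_square del: of_real_power)
  then have "((\<lambda>z. (z - w) / (1 - cnj w * z)) has_field_derivative
          of_real (1 - (cmod w)\<^sup>2) / (1 - cnj w * z)\<^sup>2) (at z)"
    by - ((rule derivative_eq_intros refl assms)+,
      use assms in \<open>simp add: algebra_simps power2_eq_square\<close>)
  then show ?thesis
    by (simp add: Moebius_function_simple[abs_def])
qed

text \<open>Conjugating by the disk automorphisms that carry \<open>a\<close> and \<open>\<omega> a\<close> to the origin reduces the
  inequality to the derivative estimate of the Schwarz lemma; the factors \<open>1 - |a|\<^sup>2\<close> and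
  \<open>1 / (1 - |\<omega> a|\<^sup>2)\<close> are the derivatives of these automorphisms.\<close>

lemma Schwarz_Pick:
  assumes hol: "\<omega> holomorphic_on ball 0 1" and self: "\<omega> ` ball 0 1 \<subseteq> ball 0 1"
    and a: "a \<in> ball 0 1"
  shows "(1 - (cmod a)\<^sup>2) * (cmod (deriv \<omega> a) / (1 - (cmod (\<omega> a))\<^sup>2)) \<le> 1"
proof -
  have lt1: "cmod (\<omega> z) < 1" if "cmod z < 1" for z
    using self that by (auto simp: image_subset_iff)
  have a1: "cmod a < 1" using a by simp
  define b where "b = \<omega> a"
  have b1: "cmod b < 1" using lt1[OF a1] by (simp add: b_def)
  have pos: "1 - (cmod a)\<^sup>2 > 0" "1 - (cmod b)\<^sup>2 > 0"
    using a1 b1 by (simp_all add: power_less_one_iff)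
  define \<phi> where "\<phi> = Moebius_function 0 b \<circ> \<omega> \<circ> Moebius_function 0 (- a)"
  have M0: "Moebius_function 0 (- a) 0 = a" by (simp add: Moebius_function_simple)
  have holphi: "\<phi> holomorphic_on ball 0 1"
    unfolding \<phi>_def
  proof (intro holomorphic_on_compose_gen[where t = "ball 0 1"] hol Moebius_function_holomorphic)
    show "cmod (- a) < 1" "cmod b < 1" using a1 b1 by auto
    show "Moebius_function 0 (- a) ` ball 0 1 \<subseteq> ball 0 1" "\<omega> ` ball 0 1 \<subseteq> ball 0 1"
      using a1 self Moebius_function_norm_lt_1[of "- a"] by auto
  qed
  have "cmod (deriv \<phi> 0) \<le> 1"
  proof (rule Schwarz_Lemma(2)[OF holphi])
    show "\<phi> 0 = 0" by (simp add: \<phi>_def M0 b_def Moebius_function_eq_zero)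
    show "cmod (\<phi> z) < 1" if "cmod z < 1" for z
      using that a1 b1 by (auto simp: \<phi>_def intro!: Moebius_function_norm_lt_1 lt1)
    show "cmod 0 < 1" by simp
  qed
  moreover have "deriv \<phi> 0 =
      of_real ((1 - (cmod a)\<^sup>2) / (1 - (cmod b)\<^sup>2)) * deriv \<omega> a"
  proof -
    have nz: "1 - cnj b * b = of_real (1 - (cmod b)\<^sup>2)"
      using complex_norm_square[of b] by (simp add: mult.commute)
    have nz0: "1 - cnj b * b \<noteq> 0"
      unfolding nz of_real_eq_0_iff using pos by simp
    have d1: "(Moebius_function 0 (- a) has_field_derivative of_real (1 - (cmod a)\<^sup>2)) (at 0)"
      using Moebius_function_has_field_derivative[of "- a" 0] by simp
    have d2: "(\<omega> has_field_derivative deriv \<omega> a) (at a)"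
      by (rule holomorphic_derivI[OF hol open_ball a])
    have d3: "(Moebius_function 0 b has_field_derivative
        of_real (1 - (cmod b)\<^sup>2) / (of_real (1 - (cmod b)\<^sup>2))\<^sup>2) (at b)"
      using Moebius_function_has_field_derivative[OF nz0] unfolding nz .
    have "(\<phi> has_field_derivative of_real (1 - (cmod b)\<^sup>2) / (of_real (1 - (cmod b)\<^sup>2))\<^sup>2
        * deriv \<omega> a * of_real (1 - (cmod a)\<^sup>2)) (at 0)"
      unfolding \<phi>_def
      by (intro DERIV_chain) (use d1 d2 d3 in \<open>simp_all add: M0 b_def\<close>)
    moreover have "complex_of_real (1 - (cmod b)\<^sup>2) \<noteq> 0"
      unfolding of_real_eq_0_iff using pos by simp
    moreover have "x / x\<^sup>2 * d * y = y / x * d" if "x \<noteq> 0" for x y d :: complex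
      using that by (simp add: power2_eq_square)
    ultimately show ?thesis
      unfolding of_real_divide by (metis DERIV_imp_deriv)
  qed
  moreover have "cmod (of_real ((1 - (cmod a)\<^sup>2) / (1 - (cmod b)\<^sup>2)))
      = (1 - (cmod a)\<^sup>2) / (1 - (cmod b)\<^sup>2)"
    unfolding norm_of_real using pos by simp
  ultimately show ?thesis
    by (simp only: norm_mult b_def) simp
qed

section \<open>Comparing the two pre-Schwarzian derivatives\<close>

text \<open>The logarithmic derivative \<open>h''/h' + g'/g\<close> of \<open>h' g\<close> occurs in both pre-Schwarzian
  derivatives and cancels.  What remains is \<open>\<omega>'\<close> times
  \<open>- cnj \<omega> / (1 - |\<omega>|\<^sup>2) - 1 / (1 + \<omega>)\<close>, whose common numerator
  \<open>cnj \<omega> (1 + \<omega>) + 1 - |\<omega>|\<^sup>2\<close> collapses to the conjugate of \<open>1 + \<omega>\<close>.\<close>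

lemma cmod_pre_schwarzian_diff:
  assumes nlh: "nonvanishing_log_harmonic f h g \<omega>" and sp: "sense_preserving_locally_univalent f"
    and z: "z \<in> unit_disk"
  shows "cmod (pre_schwarzian f z - analytic_pre_schwarzian (\<lambda>z. h z * g z) z)
    = cmod (deriv \<omega> z) / (1 - (cmod (\<omega> z))\<^sup>2)"
proof -
  have hol: "h holomorphic_on unit_disk" "g holomorphic_on unit_disk" "\<omega> holomorphic_on unit_disk"
    and self: "\<omega> ` unit_disk \<subseteq> unit_disk"
    using nlh by (simp_all add: nonvanishing_log_harmonic_def)
  have hol': "deriv h holomorphic_on unit_disk"
    using hol(1) by (simp add: holomorphic_deriv)
  have \<omega>1: "cmod (\<omega> z) < 1"
    using self z by (auto simp: image_subset_iff)
  have pos: "1 - (cmod (\<omega> z))\<^sup>2 > 0"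
    using \<omega>1 by (simp add: power_less_one_iff)
  have nz: "deriv h z \<noteq> 0" "g z \<noteq> 0"
    using log_harmonic_dilatation(1)[OF nlh sp z] by auto
  have onz: "1 + \<omega> z \<noteq> 0"
    using \<omega>1 by (metis add_eq_0_iff norm_minus_cancel norm_one less_irrefl)
  have dF: "deriv (\<lambda>z. h z * g z) w = deriv h w * g w * (1 + \<omega> w)" if w: "w \<in> unit_disk" for w
  proof -
    have "((\<lambda>z. h z * g z) has_field_derivative deriv h w * g w + deriv g w * h w) (at w)"
      by (rule DERIV_mult holomorphic_derivI[OF _ open_ball w] hol)+
    then show ?thesis
      using log_harmonic_jacobian(2)[OF nlh w] by (simp add: DERIV_imp_deriv algebra_simps)
  qed
  have "deriv (deriv (\<lambda>z. h z * g z)) z = deriv (\<lambda>w. deriv h w * g w * (1 + \<omega> w)) z"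
    by (rule complex_derivative_transform_within_open[OF _ _ open_ball z dF])
      (intro holomorphic_intros holomorphic_deriv hol hol' open_ball)+
  also have "\<dots> = (deriv (deriv h) z * g z + deriv g z * deriv h z) * (1 + \<omega> z)
      + deriv \<omega> z * (deriv h z * g z)"
  proof (rule DERIV_imp_deriv)
    have "((\<lambda>w. 1 + \<omega> w) has_field_derivative deriv \<omega> z) (at z)"
      using DERIV_add[OF DERIV_const holomorphic_derivI[OF hol(3) open_ball z], of 1] by simp
    then show "((\<lambda>w. deriv h w * g w * (1 + \<omega> w)) has_field_derivative
        (deriv (deriv h) z * g z + deriv g z * deriv h z) * (1 + \<omega> z)
      + deriv \<omega> z * (deriv h z * g z)) (at z)"
      by (intro DERIV_mult holomorphic_derivI[OF _ open_ball z] hol hol')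
  qed
  finally have "analytic_pre_schwarzian (\<lambda>z. h z * g z) z
      = deriv (deriv h) z / deriv h z + deriv g z / g z + deriv \<omega> z / (1 + \<omega> z)"
    unfolding analytic_pre_schwarzian_def dF[OF z] using nz onz
    by (simp only:) (simp add: field_simps)
  then have "pre_schwarzian f z - analytic_pre_schwarzian (\<lambda>z. h z * g z) z
      = - (cnj (\<omega> z) * deriv \<omega> z / of_real (1 - (cmod (\<omega> z))\<^sup>2)) - deriv \<omega> z / (1 + \<omega> z)"
    using pre_schwarzian_formula[OF nlh sp z] by simp
  also have "\<dots> = - (cnj (1 + \<omega> z) / (1 + \<omega> z) * (deriv \<omega> z / of_real (1 - (cmod (\<omega> z))\<^sup>2)))"
  proof -
    have eq: "complex_of_real (1 - (cmod (\<omega> z))\<^sup>2) = 1 - \<omega> z * cnj (\<omega> z)"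
      by (simp add: complex_norm_square del: of_real_power)
    have "complex_of_real (1 - (cmod (\<omega> z))\<^sup>2) \<noteq> 0"
      unfolding of_real_eq_0_iff using pos by simp
    then show ?thesis
      using onz unfolding eq by (simp add: divide_simps) (simp add: algebra_simps)
  qed
  finally show ?thesis
    using onz pos
    by (simp only: norm_minus_cancel norm_mult norm_divide complex_mod_cnj norm_of_real) simp
qed

lemma pre_schwarzian_norm_le_add:
  assumes "\<And>z. z \<in> unit_disk \<Longrightarrow> (1 - (cmod z)\<^sup>2) * cmod (P z - Q z) \<le> c"
  shows "pre_schwarzian_norm P \<le> pre_schwarzian_norm Q + ereal c"
  unfolding pre_schwarzian_norm_def
proof (rule SUP_least)
  fix z :: complex assume z: "z \<in> unit_disk"
  have "0 \<le> 1 - (cmod z)\<^sup>2"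
    using z by (simp add: power_le_one)
  then have "(1 - (cmod z)\<^sup>2) * cmod (P z)
      \<le> (1 - (cmod z)\<^sup>2) * cmod (Q z) + (1 - (cmod z)\<^sup>2) * cmod (P z - Q z)"
    using norm_triangle_sub[of "P z" "Q z"]
    by (simp add: mult_left_mono flip: distrib_left)
  also have "\<dots> \<le> (1 - (cmod z)\<^sup>2) * cmod (Q z) + c"
    using assms[OF z] by simp
  finally have "ereal ((1 - (cmod z)\<^sup>2) * cmod (P z))
      \<le> ereal ((1 - (cmod z)\<^sup>2) * cmod (Q z)) + ereal c"
    by simp
  also have "\<dots> \<le> (SUP z\<in>unit_disk. ereal ((1 - (cmod z)\<^sup>2) * cmod (Q z))) + ereal c"
    by (rule add_right_mono SUP_upper z)+
  finally show "ereal ((1 - (cmod z)\<^sup>2) * cmod (P z))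
      \<le> (SUP z\<in>unit_disk. ereal ((1 - (cmod z)\<^sup>2) * cmod (Q z))) + ereal c" .
qed

lemma pre_schwarzian_norm_nonneg: "0 \<le> pre_schwarzian_norm P"
  unfolding pre_schwarzian_norm_def by (rule SUP_upper2[where i = 0]) auto

lemma pre_schwarzian_norm_eq_const:
  assumes "\<And>z. z \<in> unit_disk \<Longrightarrow> (1 - (cmod z)\<^sup>2) * cmod (P z) = c"
  shows "pre_schwarzian_norm P = ereal c"
  unfolding pre_schwarzian_norm_def using assms by (intro SUP_eq_const) auto

text \<open>The inequalities \<open>A \<le> B + 1\<close> and \<open>B \<le> A + 1\<close> hold in \<open>[0, \<infinity>]\<close>, so they transfer
  finiteness between the two norms as well as bounding the difference of finite ones.\<close>

lemma pre_schwarzian_norm_log_harmonic_vs_analytic: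
  assumes nlh: "nonvanishing_log_harmonic f h g \<omega>" and sp: "sense_preserving_locally_univalent f"
  defines "A \<equiv> pre_schwarzian_norm (pre_schwarzian f)"
    and "B \<equiv> pre_schwarzian_norm (analytic_pre_schwarzian (\<lambda>z. h z * g z))"
  shows "(A = \<infinity> \<and> B = \<infinity>) \<or> (A < \<infinity> \<and> B < \<infinity>)" and "A < \<infinity> \<Longrightarrow> \<bar>A - B\<bar> \<le> 1"
proof -
  have bound: "(1 - (cmod z)\<^sup>2)
      * cmod (pre_schwarzian f z - analytic_pre_schwarzian (\<lambda>z. h z * g z) z) \<le> 1"
    if z: "z \<in> unit_disk" for z
    using nlh z unfolding cmod_pre_schwarzian_diff[OF nlh sp z]
    by (intro Schwarz_Pick) (simp_all add: nonvanishing_log_harmonic_def)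
  have "A \<le> B + ereal 1"
    unfolding A_def B_def by (rule pre_schwarzian_norm_le_add[OF bound])
  moreover have "B \<le> A + ereal 1"
    unfolding A_def B_def
    by (rule pre_schwarzian_norm_le_add) (use bound in \<open>simp add: norm_minus_commute\<close>)
  moreover have "0 \<le> A" "0 \<le> B"
    unfolding A_def B_def by (rule pre_schwarzian_norm_nonneg)+
  ultimately show "(A = \<infinity> \<and> B = \<infinity>) \<or> (A < \<infinity> \<and> B < \<infinity>)" and "A < \<infinity> \<Longrightarrow> \<bar>A - B\<bar> \<le> 1"
    by (cases A; cases B; auto simp: abs_le_iff one_ereal_def)+
qed

section \<open>Sharpness\<close>

text \<open>Turns the equation of log-harmonicity into the relation \<open>g' h = \<omega> h' g\<close> between
  holomorphic functions, which can be verified by differentiating \<open>h\<close> and \<open>g\<close> alone.\<close>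

lemma nonvanishing_log_harmonicI:
  assumes hol: "h holomorphic_on unit_disk" "g holomorphic_on unit_disk"
    and \<omega>: "\<omega> holomorphic_on unit_disk" "\<omega> ` unit_disk \<subseteq> unit_disk"
    and nz: "\<And>z. z \<in> unit_disk \<Longrightarrow> h z \<noteq> 0" "\<And>z. z \<in> unit_disk \<Longrightarrow> g z \<noteq> 0"
    and dil: "\<And>z. z \<in> unit_disk \<Longrightarrow> deriv g z * h z = \<omega> z * (deriv h z * g z)"
  shows "nonvanishing_log_harmonic (\<lambda>z. h z * cnj (g z)) h g \<omega>"
proof -
  let ?f = "\<lambda>z. h z * cnj (g z)"
  have "cnj (wirtinger_zbar ?f z) / cnj (?f z) = \<omega> z * (wirtinger_z ?f z / ?f z)"
    if z: "z \<in> unit_disk" for z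
  proof -
    have dh: "(h has_derivative (*) (deriv h z)) (at z)"
      and dg: "(g has_derivative (*) (deriv g z)) (at z)"
      using hol[THEN holomorphic_derivI, OF open_ball z]
      by (auto simp: has_field_derivative_def)
    have "(?f has_derivative
          (\<lambda>w. (deriv h z * cnj (g z)) * w + (h z * cnj (deriv g z)) * cnj w)) (at z)"
      by (rule derivative_eq_intros bounded_linear.has_derivative[OF bounded_linear_cnj] dh dg
          | simp add: algebra_simps)+
    from wirtinger_eqI[OF this] show ?thesis
      using nz[OF z] dil[OF z] by (simp add: field_simps)
  qed
  then show ?thesis
    unfolding nonvanishing_log_harmonic_def using hol \<omega> nz by blast
qed

text \<open>Because \<open>1 + z\<close> has vanishing pre-Schwarzian derivative and \<open>\<omega> z = z\<close> has hyperbolic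
  derivative \<open>1 / (1 - |z|\<^sup>2)\<close>, the weighted modulus of \<open>P\<^sub>f\<close> is identically 1: the supremum is
  attained at every point of the disk.\<close>

lemma pre_schwarzian_norms_differ_by_one:
  "\<exists>f h g \<omega>. nonvanishing_log_harmonic f h g \<omega> \<and> sense_preserving_locally_univalent f \<and>
     pre_schwarzian_norm (pre_schwarzian f) = 1 \<and>
     pre_schwarzian_norm (analytic_pre_schwarzian (\<lambda>z. h z * g z)) = 0"
proof -
  define h :: "complex \<Rightarrow> complex" where "h = (\<lambda>z. exp (- (1 / (1 + z))))"
  define g :: "complex \<Rightarrow> complex" where "g = (\<lambda>z. (1 + z) * exp (1 / (1 + z)))"
  let ?f = "\<lambda>z. h z * cnj (g z)" and ?\<omega> = "\<lambda>z::complex. z"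
  have nz: "1 + z \<noteq> 0" if "z \<in> unit_disk" for z :: complex
    using that by (metis add_eq_0_iff mem_ball_0 norm_minus_cancel norm_one less_irrefl)
  have dh: "deriv h z = h z / (1 + z)\<^sup>2" if "z \<in> unit_disk" for z
    unfolding h_def
    by (rule DERIV_imp_deriv, (rule derivative_eq_intros refl nz[OF that])+)
      (use nz[OF that] in \<open>simp add: field_simps power2_eq_square\<close>)
  have dg: "deriv g z = exp (1 / (1 + z)) * z / (1 + z)" if "z \<in> unit_disk" for z
    unfolding g_def
    by (rule DERIV_imp_deriv, (rule derivative_eq_intros refl nz[OF that])+)
      (use nz[OF that] in \<open>simp add: divide_simps power2_eq_square\<close>, simp add: algebra_simps)
  have nlh: "nonvanishing_log_harmonic ?f h g ?\<omega>"
  proof (rule nonvanishing_log_harmonicI)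
    show "h holomorphic_on unit_disk" "g holomorphic_on unit_disk"
      unfolding h_def g_def using nz by (auto intro!: holomorphic_intros)
    fix z assume z: "z \<in> unit_disk"
    show "h z \<noteq> 0" "g z \<noteq> 0" using nz[OF z] by (auto simp: h_def g_def)
    show "deriv g z * h z = z * (deriv h z * g z)"
      unfolding dh[OF z] dg[OF z] using nz[OF z] by (simp add: g_def power2_eq_square)
  qed auto
  have sp: "sense_preserving_locally_univalent ?f"
    unfolding sense_preserving_locally_univalent_def
  proof
    fix z :: complex assume z: "z \<in> unit_disk"
    have "deriv h z * g z \<noteq> 0"
      unfolding dh[OF z] using nz[OF z] by (simp add: h_def g_def)
    moreover have "1 - (cmod z)\<^sup>2 > 0"
      using z by (simp add: power_less_one_iff)
    ultimately show "jacobian ?f z > 0"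
      unfolding log_harmonic_jacobian(1)[OF nlh z] by simp
  qed
  have "(\<lambda>z. h z * g z) = (\<lambda>z. 1 + z)"
    by (simp add: h_def g_def fun_eq_iff exp_minus)
  moreover have "deriv (\<lambda>z::complex. 1 + z) = (\<lambda>_. 1)"
    by (rule ext, rule DERIV_imp_deriv) (auto intro!: derivative_eq_intros)
  ultimately have P_hg: "analytic_pre_schwarzian (\<lambda>z. h z * g z) = (\<lambda>_. 0)"
    by (intro ext) (simp add: analytic_pre_schwarzian_def)
  have "pre_schwarzian_norm (pre_schwarzian ?f) = ereal 1"
  proof (rule pre_schwarzian_norm_eq_const)
    fix z :: complex assume z: "z \<in> unit_disk"
    have "1 - (cmod z)\<^sup>2 > 0"
      using z by (simp add: power_less_one_iff)
    then show "(1 - (cmod z)\<^sup>2) * cmod (pre_schwarzian ?f z) = 1"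
      using cmod_pre_schwarzian_diff[OF nlh sp z] by (simp add: P_hg)
  qed
  moreover have "pre_schwarzian_norm (analytic_pre_schwarzian (\<lambda>z. h z * g z)) = ereal 0"
    by (rule pre_schwarzian_norm_eq_const) (simp add: P_hg)
  ultimately show ?thesis
    using nlh sp unfolding one_ereal_def zero_ereal_def by blast
qed

section \<open>The norm comparison theorem\<close>

theorem theorem2p1:
  "(\<forall>f h g \<omega>. nonvanishing_log_harmonic f h g \<omega> \<and> sense_preserving_locally_univalent f \<longrightarrow>
      ((pre_schwarzian_norm (pre_schwarzian f) = \<infinity> \<and>
        pre_schwarzian_norm (analytic_pre_schwarzian (\<lambda>z. h z * g z)) = \<infinity>) \<or>
       (pre_schwarzian_norm (pre_schwarzian f) < \<infinity> \<and>
        pre_schwarzian_norm (analytic_pre_schwarzian (\<lambda>z. h z * g z)) < \<infinity>)) \<and>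
      (pre_schwarzian_norm (pre_schwarzian f) < \<infinity> \<longrightarrow>
       \<bar>pre_schwarzian_norm (pre_schwarzian f)
         - pre_schwarzian_norm (analytic_pre_schwarzian (\<lambda>z. h z * g z))\<bar> \<le> 1)) \<and>
   (\<forall>C::real. C < 1 \<longrightarrow>
      (\<exists>f h g \<omega>. nonvanishing_log_harmonic f h g \<omega> \<and> sense_preserving_locally_univalent f \<and>
         pre_schwarzian_norm (pre_schwarzian f) < \<infinity> \<and>
         \<bar>pre_schwarzian_norm (pre_schwarzian f)
           - pre_schwarzian_norm (analytic_pre_schwarzian (\<lambda>z. h z * g z))\<bar> > ereal C))"
proof (rule conjI; intro allI impI)
  fix f h g \<omega>
  assume "nonvanishing_log_harmonic f h g \<omega> \<and> sense_preserving_locally_univalent f"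
  then have nlh: "nonvanishing_log_harmonic f h g \<omega>"
    and sp: "sense_preserving_locally_univalent f"
    by auto
  show "((pre_schwarzian_norm (pre_schwarzian f) = \<infinity> \<and>
        pre_schwarzian_norm (analytic_pre_schwarzian (\<lambda>z. h z * g z)) = \<infinity>) \<or>
       (pre_schwarzian_norm (pre_schwarzian f) < \<infinity> \<and>
        pre_schwarzian_norm (analytic_pre_schwarzian (\<lambda>z. h z * g z)) < \<infinity>)) \<and>
      (pre_schwarzian_norm (pre_schwarzian f) < \<infinity> \<longrightarrow>
       \<bar>pre_schwarzian_norm (pre_schwarzian f)
         - pre_schwarzian_norm (analytic_pre_schwarzian (\<lambda>z. h z * g z))\<bar> \<le> 1)"
    using pre_schwarzian_norm_log_harmonic_vs_analytic[OF nlh sp] by blast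
next
  fix C :: real
  assume "C < 1"
  obtain f h g \<omega> where "nonvanishing_log_harmonic f h g \<omega>" "sense_preserving_locally_univalent f"
    and norms: "pre_schwarzian_norm (pre_schwarzian f) = 1"
      "pre_schwarzian_norm (analytic_pre_schwarzian (\<lambda>z. h z * g z)) = 0"
    using pre_schwarzian_norms_differ_by_one by blast
  moreover have "pre_schwarzian_norm (pre_schwarzian f) < \<infinity>"
    "\<bar>pre_schwarzian_norm (pre_schwarzian f)
       - pre_schwarzian_norm (analytic_pre_schwarzian (\<lambda>z. h z * g z))\<bar> > ereal C"
    unfolding norms using \<open>C < 1\<close> by auto
  ultimately show "\<exists>f h g \<omega>. nonvanishing_log_harmonic f h g \<omega> \<and>
      sense_preserving_locally_univalent f \<and>
      pre_schwarzian_norm (pre_schwarzian f) < \<infinity> \<and>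
      \<bar>pre_schwarzian_norm (pre_schwarzian f)
        - pre_schwarzian_norm (analytic_pre_schwarzian (\<lambda>z. h z * g z))\<bar> > ereal C"
    by blast
qed

end
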